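(* Let $\{U^n_h\}_{n=0}^N$ be the fine-grid solution produced by Algorithm 4.2 (described in the context). If $$\Delta t\le\min\left\{\frac12,\frac{7\nu_0^2}{8\mu_0^2K_1^2T}\right\},$$ then, for any $n\ge1$ (with $t_n\le T$), $$\|U^n_h\|+\Big(\sum_{i=1}^n\|U^i_h-U^{i-1}_h\|^2\Big)^{1/2}+\frac{\sqrt{\nu_0}}{2}\Big(\sum_{i=1}^n\Delta t\,\|U^i_h\|_1^2\Big)^{1/2}\le C\Big(\|U^0_h\|^2+\Delta t\,\|U^0_H\|_1^2+\Delta t\sum_{i=1}^n\|f^i\|^2\Big)^{1/2},$$ where $C>0$ is a constant independent of $h$, $H$, $\Delta t$ and $n$.
   Context: Setting. $\Omega\subset\mathbb R^d$ ($d\ge1$) is a bounded polyhedral domain with piecewise smooth boundary, $T>0$, $\mathcal H^1_0=\mathcal H^1_0(\Omega)$; $(\cdot,\cdot)$ and $\|\cdot\|$ are the $L^2(\Omega)$ inner product and norm, $\|\cdot\|_1$ is the $\mathcal H^1(\Omega)$ norm. The problem is $u_t+Au+\int_0^tK(t-s)Bu(s)\,ds=f$ in $\Omega\times(0,T]$, $u=0$ on $\partial\Omega\times(0,T]$, $u(\cdot,0)=u_0$, with $K$ a (smooth or nonsmooth) memory kernel, $f$ known, $A$ a symmetric positive definite second-order elliptic operator with coefficients smooth in $x$ and $t$, and $Bu=-\nabla\cdot(\alpha(u)\nabla u+\beta(u))+\gamma(u)\cdot\nabla u+g(u)$, where $\alpha(x,u)\in\mathbb R^{d\times d}$, $\beta(x,u),\gamma(x,u)\in\mathbb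 R^d$, $g(x,u)\in\mathbb R$ (dependence on $x$ suppressed) are smooth and bounded together with their derivatives, and $\beta(0)=0$, $g(0)=0$. $A(\cdot,\cdot)$ is the bilinear form of $A$ on $\mathcal H^1_0\times \mathcal H^1_0$ (possible $t$-dependence suppressed), with $A(v,v)\ge\nu_0\|v\|_1^2$ and $|A(u,v)|\le\nu_1\|u\|_1\|v\|_1$. Set $\tilde B(w;u,v)=(\alpha(w)\nabla u+\beta(w),\nabla v)+(\gamma(w)\cdot\nabla u+g(w),v)$ and $B(u,v)=\tilde B(u;u,v)$. The constant $\mu_0>0$ (which exists by the assumptions on the coefficients) satisfies $|B(u,v)|\le\mu_0\|u\|_1\|v\|_1$. Spaces. $\{S_h\}_{0<h\le1}$ are finite-dimensional subspaces of $\mathcal H^1_0$ with $\inf_{\chi\in S_h}\{\|v-\chi\|+h\|v-\chi\|_1\}\le C h^r\|v\|_r$ for $v\in \mathcal H^r\cap \mathcal H^1_0$ ($r\ge1+\frac d2$), and $\|\nabla\chi\|_\infty\le Ch^{-d/2}\|\nabla\chi\|$ for $\chi\in S_h$, with $C$ independent of $h$. $S_H$ (coarse, mesh size $H$) and $S_h$ (fine, mesh size $h\ll H$) are two members of this family, built on triangulations $\mathcal T_H$ and $\mathcal T_h$ of $\Omega$. Time discretization. $N$ is a positive integer, $\Delta t=T/N$, $t_n=n\Delta t$, $f^n=f(t_n)$. The weights $\omega_{ni}$ of the quadrature $\Delta t\sum_{i=1}^n\omega_{ni}\phi(t_i)=\int_0^{t_n}K(t_n-s)\phi(s)\,ds+O(\Delta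 t)$ satisfy $|\omega_{ni}|\le K_1$ for $1\le i\le n\le N$ and $\omega_{nn}\ne0$. Algorithm 4.2. Step one (coarse grid): $U^0_H=u^0_H\in S_H$ (an approximation of $u_0$), and for $1\le n\le N$ find $U^n_H\in S_H$ with $\frac1{\Delta t}(U^n_H-U^{n-1}_H,v)+A(U^n_H,v)+\Delta t\sum_{i=1}^n\omega_{ni}\tilde B(U^i_H;U^i_H,v)=(f^n,v)$ for all $v\in S_H$. Step two (fine grid): $U^0_h=u^0_h\in S_h$ (an approximation of $u_0$), and for $1\le n\le N$ find $U^n_h\in S_h$ with $\frac1{\Delta t}(U^n_h-U^{n-1}_h,v)+A(U^n_h,v)+\Delta t\sum_{i=1}^{n-1}\omega_{ni}\tilde B(U^i_h;U^i_h,v)+\Delta t\,\omega_{nn}\tilde B(U^n_H;U^n_H,v)=(f^n,v)$ for all $v\in S_h$. *)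

theory Defs
  imports "HOL-Analysis.Analysis" "HOL-Probability.Essential_Supremum"
begin

text \<open>The faces of the boundary are flat, so the boundary is automatically piecewise smooth.\<close>

definition polyhedral_domain :: "(real^'d) set \<Rightarrow> bool" where
  "polyhedral_domain \<Omega> \<longleftrightarrow> \<Omega> \<noteq> {} \<and> open \<Omega> \<and> connected \<Omega> \<and> bounded \<Omega> \<and>
     (\<exists>F. finite F \<and> (\<forall>p\<in>F. polytope p \<and> aff_dim p = int CARD('d) - 1) \<and> frontier \<Omega> = \<Union>F)"


section \<open>Smooth functions\<close>

primrec iter_deriv ::
    "'a::euclidean_space list \<Rightarrow> ('a \<Rightarrow> 'b::real_normed_vector) \<Rightarrow> 'a \<Rightarrow> 'b" where
  "iter_deriv [] f = f"
| "iter_deriv (b # bs) f = (\<lambda>x. frechet_derivative (iter_deriv bs f) (at x) b)"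

text \<open>For an open set \<open>S\<close> this is \<open>C\<^sup>\<infinity>\<close>: partial derivatives of every order exist and are
  differentiable, hence continuous.\<close>

definition smooth_on :: "'a::euclidean_space set \<Rightarrow> ('a \<Rightarrow> 'b::real_normed_vector) \<Rightarrow> bool" where
  "smooth_on S f \<longleftrightarrow> (\<forall>bs\<in>lists Basis. \<forall>x\<in>S. iter_deriv bs f differentiable at x)"

definition smooth_bounded_on ::
    "'a::euclidean_space set \<Rightarrow> ('a \<Rightarrow> 'b::real_normed_vector) \<Rightarrow> bool" where
  "smooth_bounded_on S f \<longleftrightarrow> smooth_on S f \<and> (\<forall>bs\<in>lists Basis. bounded (iter_deriv bs f ` S))"

definition test_fun :: "(real^'d) set \<Rightarrow> (real^'d \<Rightarrow> real) \<Rightarrow> bool" where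
  "test_fun \<Omega> \<phi> \<longleftrightarrow> smooth_on UNIV \<phi> \<and>
     compact (closure {x. \<phi> x \<noteq> 0}) \<and> closure {x. \<phi> x \<noteq> 0} \<subseteq> \<Omega>"


section \<open>Lebesgue and Sobolev spaces\<close>

text \<open>Elements of the function spaces are representatives, that is, functions defined everywhere
  of which only the values almost everywhere in \<open>\<Omega>\<close> matter.\<close>

definition L2 :: "(real^'d) set \<Rightarrow> (real^'d \<Rightarrow> real) set" where
  "L2 \<Omega> = {u. u \<in> borel_measurable (lebesgue_on \<Omega>) \<and> integrable (lebesgue_on \<Omega>) (\<lambda>x. (u x)\<^sup>2)}"

definition L2_inner :: "(real^'d) set \<Rightarrow> (real^'d \<Rightarrow> 'b::real_inner) \<Rightarrow> (real^'d \<Rightarrow> 'b) \<Rightarrow> real" where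
  "L2_inner \<Omega> u v = (LINT x|lebesgue_on \<Omega>. u x \<bullet> v x)"

definition L2_norm :: "(real^'d) set \<Rightarrow> (real^'d \<Rightarrow> 'b::real_inner) \<Rightarrow> real" where
  "L2_norm \<Omega> u = sqrt (L2_inner \<Omega> u u)"

text \<open>A multi-index is a function \<open>'d \<Rightarrow> nat\<close>. It is turned into a list of coordinate directions;
  only smooth functions are differentiated along that list, so the order chosen is immaterial.\<close>

definition multi_dirs :: "('d::finite \<Rightarrow> nat) \<Rightarrow> (real^'d) list" where
  "multi_dirs m = (SOME bs. set bs \<subseteq> Basis \<and> (\<forall>i. count_list bs (axis i 1) = m i))"

definition has_weak_deriv ::
    "(real^'d) set \<Rightarrow> ('d \<Rightarrow> nat) \<Rightarrow> (real^'d \<Rightarrow> real) \<Rightarrow> (real^'d \<Rightarrow> real) \<Rightarrow> bool" where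
  "has_weak_deriv \<Omega> m u w \<longleftrightarrow> w \<in> L2 \<Omega> \<and>
     (\<forall>\<phi>. test_fun \<Omega> \<phi> \<longrightarrow>
        L2_inner \<Omega> u (iter_deriv (multi_dirs m) \<phi>) = (-1) ^ (\<Sum>i\<in>UNIV. m i) * L2_inner \<Omega> w \<phi>)"

text \<open>Weak derivatives are unique only almost everywhere, so one is chosen; for order zero the
  function itself is taken.\<close>

definition weak_deriv ::
    "(real^'d) set \<Rightarrow> ('d \<Rightarrow> nat) \<Rightarrow> (real^'d \<Rightarrow> real) \<Rightarrow> real^'d \<Rightarrow> real" where
  "weak_deriv \<Omega> m u = (if m = (\<lambda>_. 0) then u else (SOME w. has_weak_deriv \<Omega> m u w))"

definition weak_grad :: "(real^'d) set \<Rightarrow> (real^'d \<Rightarrow> real) \<Rightarrow> real^'d \<Rightarrow> real^'d" where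
  "weak_grad \<Omega> u x = (\<chi> i. weak_deriv \<Omega> (\<lambda>j. if j = i then 1 else 0) u x)"

definition Hsp :: "(real^'d) set \<Rightarrow> nat \<Rightarrow> (real^'d \<Rightarrow> real) set" where
  "Hsp \<Omega> k = {u \<in> L2 \<Omega>. \<forall>m. (\<Sum>i\<in>UNIV. m i) \<le> k \<longrightarrow> (\<exists>w. has_weak_deriv \<Omega> m u w)}"

definition Hnorm :: "(real^'d) set \<Rightarrow> nat \<Rightarrow> (real^'d \<Rightarrow> real) \<Rightarrow> real" where
  "Hnorm \<Omega> k u = sqrt (\<Sum>m\<in>{m. (\<Sum>i\<in>UNIV. m i) \<le> k}. (L2_norm \<Omega> (weak_deriv \<Omega> m u))\<^sup>2)"

text \<open>\<open>H\<^sup>1\<^sub>0\<close> is the closure of the test functions in \<open>H\<^sup>1\<close>.\<close>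

definition H10 :: "(real^'d) set \<Rightarrow> (real^'d \<Rightarrow> real) set" where
  "H10 \<Omega> = {u \<in> Hsp \<Omega> 1. \<forall>\<epsilon>>0. \<exists>\<phi>. test_fun \<Omega> \<phi> \<and> Hnorm \<Omega> 1 (\<lambda>x. u x - \<phi> x) < \<epsilon>}"


section \<open>Operators and bilinear forms\<close>

text \<open>\<open>A u = - \<nabla> \<cdot> (a \<nabla>u) + a\<^sub>0 u\<close> with coefficients depending on \<open>(x, t)\<close>; with real smooth
  coefficients every symmetric second-order operator has this form. Smoothness on the closed set
  \<open>closure \<Omega> \<times> {0..T}\<close> is smoothness on an open neighbourhood. Positive definiteness of the
  operator is coercivity of the form below, which is assumed separately with its constant.\<close>

definition elliptic_coeffs ::
    "(real^'d) set \<Rightarrow> real \<Rightarrow> ((real^'d) \<times> real \<Rightarrow> real^'d^'d) \<Rightarrow> ((real^'d) \<times> real \<Rightarrow> real) \<Rightarrow> bool" where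
  "elliptic_coeffs \<Omega> T a a0 \<longleftrightarrow>
     (\<exists>W. open W \<and> closure \<Omega> \<times> {0..T} \<subseteq> W \<and> smooth_on W a \<and> smooth_on W a0) \<and>
     (\<forall>x\<in>\<Omega>. \<forall>t\<in>{0..T}. transpose (a (x, t)) = a (x, t)) \<and>
     (\<exists>c>0. \<forall>x\<in>\<Omega>. \<forall>t\<in>{0..T}. \<forall>\<xi>. \<xi> \<bullet> (a (x, t) *v \<xi>) \<ge> c * (norm \<xi>)\<^sup>2)"

definition A_form ::
    "(real^'d) set \<Rightarrow> ((real^'d) \<times> real \<Rightarrow> real^'d^'d) \<Rightarrow> ((real^'d) \<times> real \<Rightarrow> real) \<Rightarrow>
      real \<Rightarrow> (real^'d \<Rightarrow> real) \<Rightarrow> (real^'d \<Rightarrow> real) \<Rightarrow> real" where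
  "A_form \<Omega> a a0 t u v =
     L2_inner \<Omega> (\<lambda>x. a (x, t) *v weak_grad \<Omega> u x) (weak_grad \<Omega> v) +
     L2_inner \<Omega> (\<lambda>x. a0 (x, t) * u x) v"

text \<open>The coefficients of \<open>B\<close> take the pair \<open>(x, u)\<close>, and smoothness is joint in both.\<close>

definition B_coeffs ::
    "(real^'d) set \<Rightarrow> ((real^'d) \<times> real \<Rightarrow> real^'d^'d) \<Rightarrow> ((real^'d) \<times> real \<Rightarrow> real^'d) \<Rightarrow>
      ((real^'d) \<times> real \<Rightarrow> real^'d) \<Rightarrow> ((real^'d) \<times> real \<Rightarrow> real) \<Rightarrow> bool" where
  "B_coeffs \<Omega> \<alpha> \<beta> \<gamma> g \<longleftrightarrow>
     smooth_bounded_on (\<Omega> \<times> UNIV) \<alpha> \<and> smooth_bounded_on (\<Omega> \<times> UNIV) \<beta> \<and>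
     smooth_bounded_on (\<Omega> \<times> UNIV) \<gamma> \<and> smooth_bounded_on (\<Omega> \<times> UNIV) g \<and>
     (\<forall>x\<in>\<Omega>. \<beta> (x, 0) = 0 \<and> g (x, 0) = 0)"

definition B_tilde ::
    "(real^'d) set \<Rightarrow> ((real^'d) \<times> real \<Rightarrow> real^'d^'d) \<Rightarrow> ((real^'d) \<times> real \<Rightarrow> real^'d) \<Rightarrow>
      ((real^'d) \<times> real \<Rightarrow> real^'d) \<Rightarrow> ((real^'d) \<times> real \<Rightarrow> real) \<Rightarrow>
      (real^'d \<Rightarrow> real) \<Rightarrow> (real^'d \<Rightarrow> real) \<Rightarrow> (real^'d \<Rightarrow> real) \<Rightarrow> real" where
  "B_tilde \<Omega> \<alpha> \<beta> \<gamma> g w u v =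
     L2_inner \<Omega> (\<lambda>x. \<alpha> (x, w x) *v weak_grad \<Omega> u x + \<beta> (x, w x)) (weak_grad \<Omega> v) +
     L2_inner \<Omega> (\<lambda>x. \<gamma> (x, w x) \<bullet> weak_grad \<Omega> u x + g (x, w x)) v"


section \<open>Finite element spaces\<close>

definition fin_dim_subspace :: "('a \<Rightarrow> real) set \<Rightarrow> bool" where
  "fin_dim_subspace V \<longleftrightarrow> (\<exists>B. finite B \<and> V = {(\<lambda>x. \<Sum>b\<in>B. c b * b x) | c. True})"

definition fe_family :: "(real^'d) set \<Rightarrow> nat \<Rightarrow> (real \<Rightarrow> (real^'d \<Rightarrow> real) set) \<Rightarrow> bool" where
  "fe_family \<Omega> r S \<longleftrightarrow>
     real r \<ge> 1 + real CARD('d) / 2 \<and>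
     (\<forall>h\<in>{0<..1}. fin_dim_subspace (S h) \<and> S h \<subseteq> H10 \<Omega>) \<and>
     (\<exists>C. \<forall>h\<in>{0<..1}.
        (\<forall>v\<in>Hsp \<Omega> r \<inter> H10 \<Omega>.
           (INF w\<in>S h. L2_norm \<Omega> (\<lambda>x. v x - w x) + h * Hnorm \<Omega> 1 (\<lambda>x. v x - w x))
             \<le> C * h ^ r * Hnorm \<Omega> r v) \<and>
        (\<forall>w\<in>S h. esssup (lebesgue_on \<Omega>) (\<lambda>x. ereal (norm (weak_grad \<Omega> w x)))
             \<le> ereal (C * h powr (- real CARD('d) / 2) * L2_norm \<Omega> (weak_grad \<Omega> w))))"


section \<open>Time discretization and the two-grid algorithm\<close>

text \<open>\<open>\<omega> N n i\<close> is the weight \<open>\<omega>\<^sub>n\<^sub>i\<close> for the step size \<open>T / N\<close>. The constant in the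
  \<open>O(T / N)\<close> quadrature error may depend on the smooth integrand, but not on \<open>N\<close> and \<open>n\<close>.\<close>

definition quadrature_weights ::
    "real \<Rightarrow> (real \<Rightarrow> real) \<Rightarrow> real \<Rightarrow> (nat \<Rightarrow> nat \<Rightarrow> nat \<Rightarrow> real) \<Rightarrow> bool" where
  "quadrature_weights T K K1 \<omega> \<longleftrightarrow>
     (\<forall>N n. 1 \<le> n \<and> n \<le> N \<longrightarrow> (\<forall>i\<in>{1..n}. \<bar>\<omega> N n i\<bar> \<le> K1) \<and> \<omega> N n n \<noteq> 0) \<and>
     (\<forall>\<phi>::real \<Rightarrow> real. smooth_on UNIV \<phi> \<longrightarrow>
        (\<exists>C. \<forall>N n. 1 \<le> n \<and> n \<le> N \<longrightarrow>
           \<bar>T / N * (\<Sum>i=1..n. \<omega> N n i * \<phi> (i * (T / N)))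
              - integral {0..n * (T / N)} (\<lambda>s. K (n * (T / N) - s) * \<phi> s)\<bar> \<le> C * (T / N)))"

text \<open>In the two steps \<open>V\<close> is the trial and test space, \<open>A t u v\<close> the elliptic form at time \<open>t\<close>,
  \<open>B w u v\<close> the form of the memory term and \<open>\<omega> n i\<close> the weights.\<close>

definition coarse_step ::
    "(real^'d) set \<Rightarrow> (real \<Rightarrow> (real^'d \<Rightarrow> real) \<Rightarrow> (real^'d \<Rightarrow> real) \<Rightarrow> real) \<Rightarrow>
      ((real^'d \<Rightarrow> real) \<Rightarrow> (real^'d \<Rightarrow> real) \<Rightarrow> (real^'d \<Rightarrow> real) \<Rightarrow> real) \<Rightarrow>
      real \<Rightarrow> nat \<Rightarrow> (nat \<Rightarrow> nat \<Rightarrow> real) \<Rightarrow> (real \<Rightarrow> real^'d \<Rightarrow> real) \<Rightarrow>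
      (real^'d \<Rightarrow> real) set \<Rightarrow> (nat \<Rightarrow> real^'d \<Rightarrow> real) \<Rightarrow> bool" where
  "coarse_step \<Omega> A B \<Delta>t N \<omega> f V U \<longleftrightarrow>
     (\<forall>n\<le>N. U n \<in> V) \<and>
     (\<forall>n\<in>{1..N}. \<forall>v\<in>V.
        1 / \<Delta>t * L2_inner \<Omega> (\<lambda>x. U n x - U (n - 1) x) v + A (n * \<Delta>t) (U n) v
          + \<Delta>t * (\<Sum>i=1..n. \<omega> n i * B (U i) (U i) v)
        = L2_inner \<Omega> (f (n * \<Delta>t)) v)"

definition fine_step ::
    "(real^'d) set \<Rightarrow> (real \<Rightarrow> (real^'d \<Rightarrow> real) \<Rightarrow> (real^'d \<Rightarrow> real) \<Rightarrow> real) \<Rightarrow>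
      ((real^'d \<Rightarrow> real) \<Rightarrow> (real^'d \<Rightarrow> real) \<Rightarrow> (real^'d \<Rightarrow> real) \<Rightarrow> real) \<Rightarrow>
      real \<Rightarrow> nat \<Rightarrow> (nat \<Rightarrow> nat \<Rightarrow> real) \<Rightarrow> (real \<Rightarrow> real^'d \<Rightarrow> real) \<Rightarrow>
      (real^'d \<Rightarrow> real) set \<Rightarrow> (nat \<Rightarrow> real^'d \<Rightarrow> real) \<Rightarrow> (nat \<Rightarrow> real^'d \<Rightarrow> real) \<Rightarrow> bool" where
  "fine_step \<Omega> A B \<Delta>t N \<omega> f V UH U \<longleftrightarrow>
     (\<forall>n\<le>N. U n \<in> V) \<and>
     (\<forall>n\<in>{1..N}. \<forall>v\<in>V.
        1 / \<Delta>t * L2_inner \<Omega> (\<lambda>x. U n x - U (n - 1) x) v + A (n * \<Delta>t) (U n) v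
          + \<Delta>t * (\<Sum>i\<in>{1..<n}. \<omega> n i * B (U i) (U i) v)
          + \<Delta>t * \<omega> n n * B (UH n) (UH n) v
        = L2_inner \<Omega> (f (n * \<Delta>t)) v)"

end

theory Submission
  imports Defs
begin

text \<open>The estimate is an energy argument: each scheme is tested with its own solution at the new
  time level. Write \<open>M = \<mu>0 * K1\<close> and \<open>\<tau> = \<Delta>t\<close>. Since \<open>2 (u - w, u)\<close> telescopes up to a square
  (\<open>L2_polarization\<close>), and since both \<open>(F, u)\<close> and the memory term are bounded by a multiple of
  \<open>\<parallel>u\<parallel>\<^sub>1\<close>, one obtains for both grids
  \<open>\<parallel>U\<^sup>n\<parallel>\<^sup>2 - \<parallel>U\<^sup>n\<^sup>-\<^sup>1\<parallel>\<^sup>2 + \<parallel>U\<^sup>n - U\<^sup>n\<^sup>-\<^sup>1\<parallel>\<^sup>2 + 2 \<tau> c \<parallel>U\<^sup>n\<parallel>\<^sub>1\<^sup>2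
    \<le> 2 \<tau> M \<parallel>U\<^sup>n\<parallel>\<^sub>1 (\<Sum>i<n. \<tau> \<parallel>U\<^sup>i\<parallel>\<^sub>1) + 2 \<tau> \<parallel>U\<^sup>n\<parallel>\<^sub>1 G\<^sub>n\<close>
  for some \<open>c > 0\<close> and some source \<open>G\<close> (\<open>scheme_energy_step\<close>). The memory sum is of the same order as
  the elliptic term, but Young's inequality and the Cauchy-Schwarz inequality in time bound it by
  \<open>\<tau>\<close> times the energy accumulated up to the previous level, so a discrete Gronwall
  argument closes the estimate with a constant that depends on \<open>M\<close>, \<open>c\<close> and \<open>T\<close> only
  (\<open>memory_energy_bound\<close>).

  On the coarse grid the last quadrature node is implicit and contributes
  \<open>2 \<tau>\<^sup>2 M \<parallel>U\<^sup>n\<parallel>\<^sub>1\<^sup>2\<close> to the right-hand side. The step size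
  restriction together with \<open>\<tau> \<le> T\<close> gives \<open>(\<tau> M)\<^sup>2 \<le> 7/8 \<nu>0\<^sup>2\<close>
  (\<open>implicit_node_absorbed\<close>), so the elliptic term absorbs it and \<open>c = \<nu>0 / 20\<close> remains. On the fine
  grid \<open>c = \<nu>0\<close> and the source is \<open>\<parallel>f\<^sup>n\<parallel> + \<tau> M \<parallel>U\<^sub>H\<^sup>n\<parallel>\<^sub>1\<close>. The extra
  factor \<open>\<tau>\<close> in front of the coarse solution turns the coarse energy bound into one by
  \<open>\<tau>\<^sup>2 \<parallel>U\<^sub>H\<^sup>0\<parallel>\<^sup>2 \<le> \<tau> \<parallel>U\<^sub>H\<^sup>0\<parallel>\<^sub>1\<^sup>2\<close>, which is why the initial coarse
  value enters the result only with the weight \<open>\<Delta>t\<close>.\<close>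


section \<open>The inner product on square integrable functions\<close>

lemma L2_mult_integrable:
  assumes "u \<in> L2 \<Omega>" "v \<in> L2 \<Omega>"
  shows "integrable (lebesgue_on \<Omega>) (\<lambda>x. u x * v x)"
proof (rule Bochner_Integration.integrable_bound)
  show "integrable (lebesgue_on \<Omega>) (\<lambda>x. (u x)\<^sup>2 + (v x)\<^sup>2)"
    using assms by (auto simp: L2_def)
  show "(\<lambda>x. u x * v x) \<in> borel_measurable (lebesgue_on \<Omega>)"
    using assms by (auto simp: L2_def)
  have "\<bar>s * t\<bar> \<le> s\<^sup>2 + t\<^sup>2" for s t :: real
  proof -
    have "2 * \<bar>s\<bar> * \<bar>t\<bar> \<le> \<bar>s\<bar>\<^sup>2 + \<bar>t\<bar>\<^sup>2" by (rule sum_squares_bound)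
    moreover have "0 \<le> \<bar>s\<bar> * \<bar>t\<bar>" by simp
    ultimately show ?thesis unfolding abs_mult power2_abs by linarith
  qed
  then show "AE x in lebesgue_on \<Omega>. norm (u x * v x) \<le> norm ((u x)\<^sup>2 + (v x)\<^sup>2)"
    by simp
qed

lemma L2_norm_square:
  fixes u :: "real^'d \<Rightarrow> real"
  shows "(L2_norm \<Omega> u)\<^sup>2 = L2_inner \<Omega> u u"
  by (simp add: L2_norm_def L2_inner_def)

lemma L2_norm_nonneg: "0 \<le> L2_norm \<Omega> (u :: real^'d \<Rightarrow> real)"
  by (simp add: L2_norm_def L2_inner_def)

lemma L2_norm_diff_scaled:
  assumes "u \<in> L2 \<Omega>" "v \<in> L2 \<Omega>"
  shows "(L2_norm \<Omega> (\<lambda>x. u x - t * v x))\<^sup>2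
           = (L2_norm \<Omega> u)\<^sup>2 - 2 * t * L2_inner \<Omega> u v + t\<^sup>2 * (L2_norm \<Omega> v)\<^sup>2"
proof -
  note uu = L2_mult_integrable[OF assms(1,1)]
    and uv = L2_mult_integrable[OF assms] and vv = L2_mult_integrable[OF assms(2,2)]
  have "(LINT x|lebesgue_on \<Omega>. (u x - t * v x) * (u x - t * v x))
      = (LINT x|lebesgue_on \<Omega>. u x * u x - (2 * t) * (u x * v x) + t\<^sup>2 * (v x * v x))"
    by (rule Bochner_Integration.integral_cong) (auto simp: power2_eq_square algebra_simps)
  also have "\<dots> = (LINT x|lebesgue_on \<Omega>. u x * u x) - 2 * t * (LINT x|lebesgue_on \<Omega>. u x * v x)
                   + t\<^sup>2 * (LINT x|lebesgue_on \<Omega>. v x * v x)"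
    using uu uv vv by (subst Bochner_Integration.integral_add Bochner_Integration.integral_diff
        Bochner_Integration.integral_mult_right_zero; auto)+
  finally show ?thesis
    unfolding L2_norm_square by (simp add: L2_inner_def)
qed

lemma L2_Cauchy_Schwarz:
  assumes "u \<in> L2 \<Omega>" "v \<in> L2 \<Omega>"
  shows "L2_inner \<Omega> u v \<le> L2_norm \<Omega> u * L2_norm \<Omega> v"
proof -
  define p q r where "p = L2_norm \<Omega> u" and "q = L2_norm \<Omega> v" and "r = L2_inner \<Omega> u v"
  have pq: "0 \<le> p" "0 \<le> q" by (auto simp: p_def q_def L2_norm_nonneg)
  have pos: "0 \<le> p\<^sup>2 - 2 * t * r + t\<^sup>2 * q\<^sup>2" for t
    using L2_norm_diff_scaled[OF assms, of t]
    unfolding p_def q_def r_def by (metis zero_le_power2)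
  have "r \<le> p * q"
  proof (cases "q = 0")
    case True
    \<comment> \<open>The quadratic in \<open>t\<close> degenerates to an affine function, which the value of \<open>t\<close> below
      makes negative if its slope is.\<close>
    have "r \<le> 0"
    proof (rule ccontr)
      assume "\<not> r \<le> 0"
      then show False
        using pos[of "(p\<^sup>2 + 1) / (2 * r)"] True by (simp add: field_simps)
    qed
    then show ?thesis using True by simp
  next
    case False
    \<comment> \<open>The quadratic is minimal at \<open>t = r / q\<^sup>2\<close>.\<close>
    have "2 * (r / q\<^sup>2) * r = 2 * (r / q)\<^sup>2" "(r / q\<^sup>2)\<^sup>2 * q\<^sup>2 = (r / q)\<^sup>2"
      using False by (simp_all add: field_simps power2_eq_square)
    then have "(r / q)\<^sup>2 \<le> p\<^sup>2"
      using pos[of "r / q\<^sup>2"] by linarith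
    then have "r / q \<le> p"
      by (rule power2_le_imp_le[OF _ pq(1)])
    then show ?thesis
      using pq False by (simp add: field_simps)
  qed
  then show ?thesis by (simp add: p_def q_def r_def)
qed

lemma L2_diff:
  assumes "u \<in> L2 \<Omega>" "v \<in> L2 \<Omega>"
  shows "(\<lambda>x. u x - v x) \<in> L2 \<Omega>"
proof -
  note uu = L2_mult_integrable[OF assms(1,1)]
    and uv = L2_mult_integrable[OF assms] and vv = L2_mult_integrable[OF assms(2,2)]
  have "integrable (lebesgue_on \<Omega>) (\<lambda>x. u x * u x - 2 * (u x * v x) + v x * v x)"
    using uu uv vv by auto
  then have "integrable (lebesgue_on \<Omega>) (\<lambda>x. (u x - v x)\<^sup>2)"
    by (simp add: power2_eq_square algebra_simps)
  then show ?thesis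
    using assms by (auto simp: L2_def)
qed

lemma L2_polarization:
  assumes "u \<in> L2 \<Omega>" "w \<in> L2 \<Omega>"
  shows "2 * L2_inner \<Omega> (\<lambda>x. u x - w x) u
           = (L2_norm \<Omega> u)\<^sup>2 - (L2_norm \<Omega> w)\<^sup>2 + (L2_norm \<Omega> (\<lambda>x. u x - w x))\<^sup>2"
proof -
  have "(L2_norm \<Omega> w)\<^sup>2 = (L2_norm \<Omega> (\<lambda>x. u x - w x - 1 * u x))\<^sup>2"
    unfolding L2_norm_square L2_inner_def by simp
  then show ?thesis
    using L2_norm_diff_scaled[OF L2_diff[OF assms] assms(1), of 1] by simp
qed

lemma finite_bounded_multi_indices:
  "finite {m :: 'd::finite \<Rightarrow> nat. (\<Sum>i\<in>UNIV. m i) \<le> k}"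
proof (rule finite_subset)
  show "{m :: 'd \<Rightarrow> nat. (\<Sum>i\<in>UNIV. m i) \<le> k} \<subseteq> PiE UNIV (\<lambda>_. {..k})"
  proof
    fix m :: "'d \<Rightarrow> nat" assume "m \<in> {m. (\<Sum>i\<in>UNIV. m i) \<le> k}"
    moreover have "m i \<le> (\<Sum>i\<in>UNIV. m i)" for i
      by (rule member_le_sum) auto
    ultimately show "m \<in> PiE UNIV (\<lambda>_. {..k})"
      by (auto intro: order_trans)
  qed
  show "finite (PiE (UNIV :: 'd set) (\<lambda>_. {..k}))"
    by (simp add: finite_PiE)
qed

lemma L2_norm_le_Hnorm: "L2_norm \<Omega> u \<le> Hnorm \<Omega> k u"
proof -
  have "(L2_norm \<Omega> (weak_deriv \<Omega> (\<lambda>_. 0) u))\<^sup>2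
      \<le> (\<Sum>m\<in>{m. (\<Sum>i\<in>UNIV. m i) \<le> k}. (L2_norm \<Omega> (weak_deriv \<Omega> m u))\<^sup>2)"
    by (rule member_le_sum) (auto simp: finite_bounded_multi_indices)
  then show ?thesis
    unfolding Hnorm_def by (intro real_le_rsqrt) (simp add: weak_deriv_def)
qed

lemma Hnorm_nonneg: "0 \<le> Hnorm \<Omega> k u"
  using L2_norm_le_Hnorm L2_norm_nonneg order_trans by blast

lemma H10_imp_L2: "u \<in> H10 \<Omega> \<Longrightarrow> u \<in> L2 \<Omega>"
  by (simp add: H10_def Hsp_def)


section \<open>A discrete energy inequality with memory\<close>

lemma discrete_Gronwall:
  fixes y e :: "nat \<Rightarrow> real"
  assumes "1 \<le> q" and "\<And>j. 0 \<le> e j"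
    and "\<And>j. j < n \<Longrightarrow> y (Suc j) \<le> q * y j + e (Suc j)"
    and "k \<le> n"
  shows "y k \<le> q ^ k * (y 0 + (\<Sum>j=1..k. e j))"
  using \<open>k \<le> n\<close>
proof (induction k)
  case 0
  then show ?case by simp
next
  case (Suc k)
  have "y (Suc k) \<le> q * y k + e (Suc k)"
    using assms(3) Suc by simp
  also have "\<dots> \<le> q * (q ^ k * (y 0 + (\<Sum>j=1..k. e j))) + q ^ Suc k * e (Suc k)"
    using Suc assms(1,2) mult_right_mono[of 1 "q ^ Suc k" "e (Suc k)"]
    by (intro add_mono mult_left_mono) (auto intro: one_le_power simp del: power_Suc)
  finally show ?case by (simp add: algebra_simps)
qed

lemma Young_two_terms:
  fixes c b s g :: real
  assumes "c > 0"
  shows "2 * b * (s + g) \<le> c * b\<^sup>2 + 2 / c * (s\<^sup>2 + g\<^sup>2)"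
proof -
  have "0 \<le> (c * b - (s + g))\<^sup>2 + (s - g)\<^sup>2" by simp
  then have "2 * b * (s + g) * c \<le> c\<^sup>2 * b\<^sup>2 + 2 * (s\<^sup>2 + g\<^sup>2)"
    by (simp add: power2_eq_square algebra_simps)
  then show ?thesis
    using assms by (simp add: field_simps power2_eq_square)
qed

text \<open>In the application \<open>a\<close>, \<open>d\<close> and \<open>b\<close> are the \<open>L\<^sup>2\<close> norms of the solution and of its increments and
  the \<open>H\<^sup>1\<close> norms of the solution. Half of the coercive term on the left survives.\<close>

lemma memory_energy_bound:
  fixes a b d G :: "nat \<Rightarrow> real"
  assumes c: "c > 0" and \<tau>: "\<tau> > 0" and T: "real n * \<tau> \<le> T"
    and step: "\<And>j. j \<in> {1..n} \<Longrightarrow>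
        (a j)\<^sup>2 - (a (j - 1))\<^sup>2 + (d j)\<^sup>2 + 2 * \<tau> * c * (b j)\<^sup>2
          \<le> 2 * \<tau> * M * b j * (\<Sum>i\<in>{1..<j}. \<tau> * b i) + 2 * \<tau> * b j * G j"
  shows "(a n)\<^sup>2 + (\<Sum>i=1..n. (d i)\<^sup>2) + c * (\<Sum>i=1..n. \<tau> * (b i)\<^sup>2)
           \<le> exp (2 * M\<^sup>2 * T\<^sup>2 / c\<^sup>2) * ((a 0)\<^sup>2 + 2 / c * (\<tau> * (\<Sum>i=1..n. (G i)\<^sup>2)))"
proof -
  define E where "E k = (\<Sum>i=1..k. \<tau> * (b i)\<^sup>2)" for k
  define y where "y k = (a k)\<^sup>2 + (\<Sum>i=1..k. (d i)\<^sup>2) + c * E k" for k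
  define L where "L = 2 * M\<^sup>2 * T / c\<^sup>2"
  define e where "e j = 2 / c * (\<tau> * (G j)\<^sup>2)" for j
  have T0: "0 \<le> T"
    using T \<tau> by (meson less_imp_le mult_nonneg_nonneg of_nat_0_le_iff order_trans)
  have L0: "0 \<le> L" using T0 by (simp add: L_def)
  have E_y: "c * E k \<le> y k" for k
    unfolding y_def by (simp add: sum_nonneg)
  have y_step: "y (Suc j) \<le> (1 + L * \<tau>) * y j + e (Suc j)" if "j < n" for j
  proof -
    define s where "s = (\<Sum>i=1..j. \<tau> * b i)"
    \<comment> \<open>Cauchy-Schwarz in time: one of the two factors \<open>\<tau>\<close> combines with the number of levels to at
      most \<open>T\<close>, the other one makes the sum of squares part of the energy.\<close>
    have "s\<^sup>2 \<le> (\<Sum>i=1..j. (\<tau> * b i)\<^sup>2) * real (card {1..j})"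
      unfolding s_def by (rule sum_squared_le_sum_of_squares)
    also have "\<dots> = real j * \<tau> * E j"
      by (simp add: E_def power_mult_distrib power2_eq_square sum_distrib_left sum_distrib_right mult_ac)
    also have "\<dots> \<le> T * E j"
    proof (rule mult_right_mono)
      have "real j * \<tau> \<le> real n * \<tau>" using that \<tau> by simp
      then show "real j * \<tau> \<le> T" using T by linarith
      show "0 \<le> E j" unfolding E_def using \<tau> by (simp add: sum_nonneg)
    qed
    also have "\<dots> \<le> T * (y j / c)"
      using E_y[of j] c T0 by (intro mult_left_mono) (auto simp: field_simps)
    finally have s: "s\<^sup>2 \<le> T * (y j / c)" .
    have "2 * b (Suc j) * (M * s + G (Suc j))
        \<le> c * (b (Suc j))\<^sup>2 + 2 / c * ((M * s)\<^sup>2 + (G (Suc j))\<^sup>2)"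
      by (rule Young_two_terms[OF c])
    then have "\<tau> * (2 * b (Suc j) * (M * s + G (Suc j)))
        \<le> \<tau> * (c * (b (Suc j))\<^sup>2 + 2 / c * ((M * s)\<^sup>2 + (G (Suc j))\<^sup>2))"
      using \<tau> by (intro mult_left_mono) auto
    moreover have "(a (Suc j))\<^sup>2 - (a j)\<^sup>2 + (d (Suc j))\<^sup>2 + 2 * \<tau> * c * (b (Suc j))\<^sup>2
        \<le> \<tau> * (2 * b (Suc j) * (M * s + G (Suc j)))"
      using step[of "Suc j"] that
      by (simp add: s_def atLeastLessThanSuc_atLeastAtMost algebra_simps)
    moreover have "2 / c * \<tau> * (M\<^sup>2 * s\<^sup>2) \<le> 2 / c * \<tau> * (M\<^sup>2 * (T * (y j / c)))"
      using s c \<tau> by (intro mult_left_mono) auto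
    moreover have "2 / c * \<tau> * (M\<^sup>2 * (T * (y j / c))) = L * \<tau> * y j"
      using c by (simp add: L_def field_simps power2_eq_square)
    moreover have "y (Suc j) = y j + (a (Suc j))\<^sup>2 - (a j)\<^sup>2 + (d (Suc j))\<^sup>2 + \<tau> * c * (b (Suc j))\<^sup>2"
      by (simp add: y_def E_def algebra_simps)
    ultimately show ?thesis
      by (simp add: e_def power_mult_distrib algebra_simps)
  qed
  have R0: "0 \<le> y 0 + (\<Sum>j=1..n. e j)"
    using c \<tau> by (auto simp: y_def E_def e_def intro!: add_nonneg_nonneg sum_nonneg)
  have "y n \<le> (1 + L * \<tau>) ^ n * (y 0 + (\<Sum>j=1..n. e j))"
    by (rule discrete_Gronwall[where n = n]) (use L0 \<tau> c y_step in \<open>auto simp: e_def\<close>)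
  also have "\<dots> \<le> exp (L * T) * (y 0 + (\<Sum>j=1..n. e j))"
  proof (rule mult_right_mono[OF _ R0])
    have "(1 + L * \<tau>) ^ n \<le> exp (L * \<tau>) ^ n"
      using L0 \<tau> by (intro power_mono) auto
    also have "\<dots> = exp (L * (real n * \<tau>))"
      by (simp add: exp_of_nat_mult[symmetric] mult_ac)
    also have "\<dots> \<le> exp (L * T)"
      using T L0 by (simp add: mult_left_mono)
    finally show "(1 + L * \<tau>) ^ n \<le> exp (L * T)" .
  qed
  also have "L * T = 2 * M\<^sup>2 * T\<^sup>2 / c\<^sup>2"
    by (simp add: L_def power2_eq_square)
  also have "y 0 + (\<Sum>j=1..n. e j) = (a 0)\<^sup>2 + 2 / c * (\<tau> * (\<Sum>i=1..n. (G i)\<^sup>2))"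
    by (simp add: y_def E_def e_def sum_distrib_left)
  finally show ?thesis by (simp add: y_def E_def)
qed

text \<open>The node of the quadrature at the new time level is kept apart as the residual \<open>R\<close>, because it is
  implicit on the coarse grid and lagged to the coarse solution on the fine grid.\<close>

lemma scheme_energy_step:
  fixes u w F :: "real^'d \<Rightarrow> real" and p Bv :: "nat \<Rightarrow> real"
  assumes u: "u \<in> H10 \<Omega>" and w: "w \<in> H10 \<Omega>" and F: "F \<in> L2 \<Omega>" and \<tau>: "\<tau> > 0"
    and eq: "1 / \<tau> * L2_inner \<Omega> (\<lambda>x. u x - w x) u + Av
               + \<tau> * (\<Sum>i\<in>{1..<n}. p i * Bv i) + R = L2_inner \<Omega> F u"
    and Av: "\<nu> * (Hnorm \<Omega> 1 u)\<^sup>2 \<le> Av"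
    and p: "\<And>i. i \<in> {1..<n} \<Longrightarrow> \<bar>p i\<bar> \<le> \<kappa>"
    and Bv: "\<And>i. i \<in> {1..<n} \<Longrightarrow> \<bar>Bv i\<bar> \<le> \<mu> * b i * Hnorm \<Omega> 1 u"
    and R: "\<bar>R\<bar> \<le> \<rho> * Hnorm \<Omega> 1 u"
  shows "(L2_norm \<Omega> u)\<^sup>2 - (L2_norm \<Omega> w)\<^sup>2 + (L2_norm \<Omega> (\<lambda>x. u x - w x))\<^sup>2
             + 2 * \<tau> * \<nu> * (Hnorm \<Omega> 1 u)\<^sup>2
           \<le> 2 * \<tau> * (\<mu> * \<kappa>) * Hnorm \<Omega> 1 u * (\<Sum>i\<in>{1..<n}. \<tau> * b i)
             + 2 * \<tau> * Hnorm \<Omega> 1 u * (L2_norm \<Omega> F + \<rho>)"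
proof -
  let ?u = "Hnorm \<Omega> 1 u"
  have "L2_inner \<Omega> F u \<le> L2_norm \<Omega> F * L2_norm \<Omega> u"
    by (rule L2_Cauchy_Schwarz[OF F H10_imp_L2[OF u]])
  also have "\<dots> \<le> L2_norm \<Omega> F * ?u"
    by (intro mult_left_mono L2_norm_le_Hnorm L2_norm_nonneg)
  finally have f: "L2_inner \<Omega> F u \<le> L2_norm \<Omega> F * ?u" .
  have "- (p i * Bv i) \<le> \<kappa> * (\<mu> * b i * ?u)" if "i \<in> {1..<n}" for i
  proof -
    have "- (p i * Bv i) \<le> \<bar>p i\<bar> * \<bar>Bv i\<bar>" by (simp add: abs_mult[symmetric])
    also have "\<dots> \<le> \<kappa> * (\<mu> * b i * ?u)"
      using p[OF that] Bv[OF that] by (intro mult_mono) auto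
    finally show ?thesis .
  qed
  then have "(\<Sum>i\<in>{1..<n}. - (p i * Bv i)) \<le> (\<Sum>i\<in>{1..<n}. \<kappa> * (\<mu> * b i * ?u))"
    by (rule sum_mono)
  also have "\<dots> = \<mu> * \<kappa> * ?u * (\<Sum>i\<in>{1..<n}. b i)"
    by (simp add: sum_distrib_left mult_ac)
  finally have m: "- (\<Sum>i\<in>{1..<n}. p i * Bv i) \<le> \<mu> * \<kappa> * ?u * (\<Sum>i\<in>{1..<n}. b i)"
    by (simp add: sum_negf)
  have "2 * L2_inner \<Omega> (\<lambda>x. u x - w x) u + 2 * \<tau> * \<nu> * ?u\<^sup>2
      \<le> 2 * L2_inner \<Omega> (\<lambda>x. u x - w x) u + 2 * \<tau> * Av"
    using Av \<tau> by simp
  also have "\<dots> = 2 * \<tau> * (L2_inner \<Omega> F u + \<tau> * - (\<Sum>i\<in>{1..<n}. p i * Bv i) - R)"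
    using eq[symmetric] \<tau> by (simp add: field_simps)
  also have "\<dots> \<le> 2 * \<tau> * (L2_norm \<Omega> F * ?u
                 + \<tau> * (\<mu> * \<kappa> * ?u * (\<Sum>i\<in>{1..<n}. b i)) + \<rho> * ?u)"
    using mult_left_mono[OF m, of \<tau>] f R \<tau> by (intro mult_left_mono) auto
  finally show ?thesis
    unfolding L2_polarization[OF H10_imp_L2[OF u] H10_imp_L2[OF w]]
    by (simp add: algebra_simps sum_distrib_left[symmetric])
qed

lemma implicit_node_absorbed:
  fixes \<tau> T \<nu> M :: real
  assumes "0 < \<tau>" "\<tau> \<le> T" "0 < \<nu>" "0 < M" "\<tau> \<le> 7 * \<nu>\<^sup>2 / (8 * M\<^sup>2 * T)"
  shows "\<tau> * M \<le> 19 / 20 * \<nu>"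
proof -
  have "0 < T" using assms by linarith
  have "\<tau> * \<tau> \<le> T * (7 * \<nu>\<^sup>2 / (8 * M\<^sup>2 * T))"
    using assms by (intro mult_mono) auto
  also have "\<dots> = 7 * \<nu>\<^sup>2 / (8 * M\<^sup>2)"
    using \<open>0 < T\<close> by simp
  finally have "(\<tau> * M)\<^sup>2 \<le> 7 / 8 * \<nu>\<^sup>2"
    using assms(4) by (simp add: field_simps power2_eq_square)
  also have "\<dots> \<le> (19 / 20 * \<nu>)\<^sup>2"
    by (simp add: power2_eq_square)
  finally show ?thesis
    by (rule power2_le_imp_le) (use assms in simp)
qed


section \<open>Stability of the two grids\<close>

text \<open>The bound on the coarse solution, in which the right-hand side contains the full
  \<open>L\<^sup>2\<close> norm of the initial value.\<close>

lemma coarse_stability: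
  assumes scheme: "coarse_step \<Omega> A B \<tau> N p f V U" and V: "V \<subseteq> H10 \<Omega>"
    and \<tau>: "\<tau> = T / real N" and T: "T > 0" and n: "n \<in> {1..N}"
    and f: "\<And>t. t \<in> {0<..T} \<Longrightarrow> f t \<in> L2 \<Omega>"
    and coercive: "\<And>t v. t \<in> {0..T} \<Longrightarrow> v \<in> H10 \<Omega> \<Longrightarrow> \<nu> * (Hnorm \<Omega> 1 v)\<^sup>2 \<le> A t v v"
    and B: "\<And>u v. u \<in> H10 \<Omega> \<Longrightarrow> v \<in> H10 \<Omega> \<Longrightarrow> \<bar>B u u v\<bar> \<le> \<mu> * Hnorm \<Omega> 1 u * Hnorm \<Omega> 1 v"
    and p: "\<And>j i. j \<in> {1..N} \<Longrightarrow> i \<in> {1..j} \<Longrightarrow> \<bar>p j i\<bar> \<le> \<kappa>"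
    and \<nu>: "\<nu> > 0"
    and small: "\<tau> * (\<mu> * \<kappa>) \<le> 19 / 20 * \<nu>"
  shows "\<nu> / 20 * (\<Sum>i=1..n. \<tau> * (Hnorm \<Omega> 1 (U i))\<^sup>2)
           \<le> exp (800 * (\<mu> * \<kappa>)\<^sup>2 * T\<^sup>2 / \<nu>\<^sup>2)
               * ((L2_norm \<Omega> (U 0))\<^sup>2 + 40 / \<nu> * (\<tau> * (\<Sum>i=1..n. (L2_norm \<Omega> (f (real i * \<tau>)))\<^sup>2)))"
proof -
  have \<tau>0: "\<tau> > 0" using \<tau> T n by auto
  have time: "real j * \<tau> \<in> {0<..T}" if "j \<in> {1..N}" for j
    using that T \<tau>0 \<tau> mult_right_mono[of "real j" "real N" \<tau>] by auto
  have mem: "U j \<in> H10 \<Omega>" if "j \<le> N" for j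
    using scheme V that by (auto simp: coarse_step_def)
  have step: "(L2_norm \<Omega> (U j))\<^sup>2 - (L2_norm \<Omega> (U (j - 1)))\<^sup>2
        + (L2_norm \<Omega> (\<lambda>x. U j x - U (j - 1) x))\<^sup>2 + 2 * \<tau> * (\<nu> / 20) * (Hnorm \<Omega> 1 (U j))\<^sup>2
      \<le> 2 * \<tau> * (\<mu> * \<kappa>) * Hnorm \<Omega> 1 (U j) * (\<Sum>i\<in>{1..<j}. \<tau> * Hnorm \<Omega> 1 (U i))
        + 2 * \<tau> * Hnorm \<Omega> 1 (U j) * L2_norm \<Omega> (f (real j * \<tau>))" if "j \<in> {1..n}" for j
  proof -
    have j: "j \<in> {1..N}" "1 \<le> j" "j \<le> N" using that n by auto
    let ?b = "Hnorm \<Omega> 1 (U j)"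
    have "U j \<in> V" using scheme j by (auto simp: coarse_step_def)
    then have "1 / \<tau> * L2_inner \<Omega> (\<lambda>x. U j x - U (j - 1) x) (U j) + A (real j * \<tau>) (U j) (U j)
        + \<tau> * (\<Sum>i=1..j. p j i * B (U i) (U i) (U j)) = L2_inner \<Omega> (f (real j * \<tau>)) (U j)"
      using scheme j(1) unfolding coarse_step_def by blast
    moreover have "{1..j} = insert j {1..<j}" using j by auto
    ultimately have "1 / \<tau> * L2_inner \<Omega> (\<lambda>x. U j x - U (j - 1) x) (U j) + A (real j * \<tau>) (U j) (U j)
        + \<tau> * (\<Sum>i\<in>{1..<j}. p j i * B (U i) (U i) (U j)) + \<tau> * (p j j * B (U j) (U j) (U j))
        = L2_inner \<Omega> (f (real j * \<tau>)) (U j)"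
      by (simp add: distrib_left)
    moreover have "\<bar>\<tau> * (p j j * B (U j) (U j) (U j))\<bar> \<le> \<tau> * (\<mu> * \<kappa>) * ?b * ?b"
    proof -
      have "\<bar>p j j\<bar> * \<bar>B (U j) (U j) (U j)\<bar> \<le> \<kappa> * (\<mu> * ?b * ?b)"
        using p[of j j] B[of "U j" "U j"] mem j by (intro mult_mono) auto
      then have "\<tau> * (\<bar>p j j\<bar> * \<bar>B (U j) (U j) (U j)\<bar>) \<le> \<tau> * (\<kappa> * (\<mu> * ?b * ?b))"
        using \<tau>0 by simp
      then show ?thesis using \<tau>0 by (simp add: abs_mult mult_ac)
    qed
    ultimately have "(L2_norm \<Omega> (U j))\<^sup>2 - (L2_norm \<Omega> (U (j - 1)))\<^sup>2
        + (L2_norm \<Omega> (\<lambda>x. U j x - U (j - 1) x))\<^sup>2 + 2 * \<tau> * \<nu> * ?b\<^sup>2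
      \<le> 2 * \<tau> * (\<mu> * \<kappa>) * ?b * (\<Sum>i\<in>{1..<j}. \<tau> * Hnorm \<Omega> 1 (U i))
        + 2 * \<tau> * ?b * (L2_norm \<Omega> (f (real j * \<tau>)) + \<tau> * (\<mu> * \<kappa>) * ?b)"
      using mem j time f coercive p B \<tau>0
      by (intro scheme_energy_step[where p = "p j" and Bv = "\<lambda>i. B (U i) (U i) (U j)"
            and Av = "A (real j * \<tau>) (U j) (U j)"]) (auto simp: less_imp_le)
    moreover have "2 * \<tau> * (\<tau> * (\<mu> * \<kappa>)) * ?b\<^sup>2 \<le> 2 * \<tau> * (19 / 20 * \<nu>) * ?b\<^sup>2"
      using small \<tau>0 by (intro mult_right_mono mult_left_mono) auto
    ultimately show ?thesis by (simp add: algebra_simps power2_eq_square)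
  qed
  have rescaled: "2 * (\<mu> * \<kappa>)\<^sup>2 * T\<^sup>2 / (\<nu> / 20)\<^sup>2 = 800 * (\<mu> * \<kappa>)\<^sup>2 * T\<^sup>2 / \<nu>\<^sup>2"
    "2 / (\<nu> / 20) = 40 / \<nu>"
    by (simp_all add: power_divide)
  have "real n * \<tau> \<le> T" using time[OF n] by simp
  then have "(L2_norm \<Omega> (U n))\<^sup>2 + (\<Sum>i=1..n. (L2_norm \<Omega> (\<lambda>x. U i x - U (i - 1) x))\<^sup>2)
        + \<nu> / 20 * (\<Sum>i=1..n. \<tau> * (Hnorm \<Omega> 1 (U i))\<^sup>2)
      \<le> exp (2 * (\<mu> * \<kappa>)\<^sup>2 * T\<^sup>2 / (\<nu> / 20)\<^sup>2)
          * ((L2_norm \<Omega> (U 0))\<^sup>2 + 2 / (\<nu> / 20) * (\<tau> * (\<Sum>i=1..n. (L2_norm \<Omega> (f (real i * \<tau>)))\<^sup>2)))"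
    using \<nu> \<tau>0 step by (intro memory_energy_bound) auto
  moreover have "0 \<le> (L2_norm \<Omega> (U n))\<^sup>2
      + (\<Sum>i=1..n. (L2_norm \<Omega> (\<lambda>x. U i x - U (i - 1) x))\<^sup>2)"
    by (simp add: sum_nonneg)
  ultimately show ?thesis unfolding rescaled by linarith
qed

lemma fine_stability:
  assumes scheme: "fine_step \<Omega> A B \<tau> N p f V UH U" and V: "V \<subseteq> H10 \<Omega>"
    and UH: "\<And>i. i \<le> N \<Longrightarrow> UH i \<in> H10 \<Omega>"
    and \<tau>: "\<tau> = T / real N" and T: "T > 0" and n: "n \<in> {1..N}"
    and f: "\<And>t. t \<in> {0<..T} \<Longrightarrow> f t \<in> L2 \<Omega>"
    and coercive: "\<And>t v. t \<in> {0..T} \<Longrightarrow> v \<in> H10 \<Omega> \<Longrightarrow> \<nu> * (Hnorm \<Omega> 1 v)\<^sup>2 \<le> A t v v"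
    and B: "\<And>u v. u \<in> H10 \<Omega> \<Longrightarrow> v \<in> H10 \<Omega> \<Longrightarrow> \<bar>B u u v\<bar> \<le> \<mu> * Hnorm \<Omega> 1 u * Hnorm \<Omega> 1 v"
    and p: "\<And>j i. j \<in> {1..N} \<Longrightarrow> i \<in> {1..j} \<Longrightarrow> \<bar>p j i\<bar> \<le> \<kappa>"
    and \<nu>: "\<nu> > 0"
  shows "(L2_norm \<Omega> (U n))\<^sup>2 + (\<Sum>i=1..n. (L2_norm \<Omega> (\<lambda>x. U i x - U (i - 1) x))\<^sup>2)
             + \<nu> * (\<Sum>i=1..n. \<tau> * (Hnorm \<Omega> 1 (U i))\<^sup>2)
           \<le> exp (2 * (\<mu> * \<kappa>)\<^sup>2 * T\<^sup>2 / \<nu>\<^sup>2)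
               * ((L2_norm \<Omega> (U 0))\<^sup>2
                  + 2 / \<nu> * (\<tau> * (\<Sum>i=1..n. (L2_norm \<Omega> (f (real i * \<tau>))
                                              + \<tau> * (\<mu> * \<kappa>) * Hnorm \<Omega> 1 (UH i))\<^sup>2)))"
proof (rule memory_energy_bound)
  show \<tau>0: "\<tau> > 0" using \<tau> T n by auto
  have time: "real j * \<tau> \<in> {0<..T}" if "j \<in> {1..N}" for j
    using that T \<tau>0 \<tau> mult_right_mono[of "real j" "real N" \<tau>] by auto
  show "real n * \<tau> \<le> T" using time[OF n] by simp
  show "\<nu> > 0" by (rule \<nu>)
  have mem: "U j \<in> H10 \<Omega>" if "j \<le> N" for j
    using scheme V that by (auto simp: fine_step_def)
  fix j assume "j \<in> {1..n}"
  then have j: "j \<in> {1..N}" "1 \<le> j" "j \<le> N" using n by auto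
  let ?b = "Hnorm \<Omega> 1 (U j)"
  have "U j \<in> V" using scheme j by (auto simp: fine_step_def)
  then have "1 / \<tau> * L2_inner \<Omega> (\<lambda>x. U j x - U (j - 1) x) (U j) + A (real j * \<tau>) (U j) (U j)
      + \<tau> * (\<Sum>i\<in>{1..<j}. p j i * B (U i) (U i) (U j)) + \<tau> * p j j * B (UH j) (UH j) (U j)
      = L2_inner \<Omega> (f (real j * \<tau>)) (U j)"
    using scheme j by (auto simp: fine_step_def)
  moreover have "\<bar>\<tau> * p j j * B (UH j) (UH j) (U j)\<bar> \<le> \<tau> * (\<mu> * \<kappa>) * Hnorm \<Omega> 1 (UH j) * ?b"
  proof -
    have "\<bar>p j j\<bar> * \<bar>B (UH j) (UH j) (U j)\<bar> \<le> \<kappa> * (\<mu> * Hnorm \<Omega> 1 (UH j) * ?b)"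
      using p[of j j] B[of "UH j" "U j"] UH[of j] mem j by (intro mult_mono) auto
    then have "\<tau> * (\<bar>p j j\<bar> * \<bar>B (UH j) (UH j) (U j)\<bar>)
        \<le> \<tau> * (\<kappa> * (\<mu> * Hnorm \<Omega> 1 (UH j) * ?b))"
      using \<tau>0 by simp
    then show ?thesis using \<tau>0 by (simp add: abs_mult mult_ac)
  qed
  ultimately show "(L2_norm \<Omega> (U j))\<^sup>2 - (L2_norm \<Omega> (U (j - 1)))\<^sup>2
        + (L2_norm \<Omega> (\<lambda>x. U j x - U (j - 1) x))\<^sup>2 + 2 * \<tau> * \<nu> * ?b\<^sup>2
      \<le> 2 * \<tau> * (\<mu> * \<kappa>) * ?b * (\<Sum>i\<in>{1..<j}. \<tau> * Hnorm \<Omega> 1 (U i))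
        + 2 * \<tau> * ?b * (L2_norm \<Omega> (f (real j * \<tau>)) + \<tau> * (\<mu> * \<kappa>) * Hnorm \<Omega> 1 (UH j))"
    using mem j time f coercive p B \<tau>0
    by (intro scheme_energy_step[where p = "p j" and Bv = "\<lambda>i. B (U i) (U i) (U j)"
          and Av = "A (real j * \<tau>) (U j) (U j)"]) (auto simp: less_imp_le)
qed

text \<open>The coarse bound enters the fine one with the factor \<open>\<tau>\<^sup>2\<close>. Here \<open>P\<close> and \<open>Q\<close> are the exponential
  factors of the two bounds, \<open>X\<close> the fine energy, \<open>Y\<close> the sum of the squared
  coarse \<open>H\<^sup>1\<close> norms weighted with \<open>\<tau>\<close>, \<open>s\<close> the
  contribution of \<open>f\<close>, \<open>x\<close> the squared initial fine norm, and \<open>y\<close> and \<open>z\<close> the squared initial coarse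
  \<open>L\<^sup>2\<close> and \<open>H\<^sup>1\<close> norms.\<close>

lemma combine_grid_bounds:
  fixes \<tau> \<nu> M P Q s x y z X Y :: real
  assumes \<tau>: "0 < \<tau>" "\<tau> \<le> 1" and \<nu>: "0 < \<nu>" and PQ: "1 \<le> P" "1 \<le> Q"
    and nonneg: "0 \<le> x" "0 \<le> s" and y: "0 \<le> y" "y \<le> z"
    and coarse: "\<nu> / 20 * Y \<le> Q * (y + 40 / \<nu> * s)"
    and fine: "X \<le> P * (x + 2 / \<nu> * (2 * s + 2 * (\<tau> * M)\<^sup>2 * Y))"
  shows "X \<le> P * (1 + 4 / \<nu> + 80 / \<nu>\<^sup>2 * M\<^sup>2 * Q * (1 + 40 / \<nu>)) * (x + \<tau> * z + s)"
proof -
  let ?R = "x + \<tau> * z + s"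
  have R: "0 \<le> \<tau> * z" "x \<le> ?R" "s \<le> ?R" "\<tau> * z \<le> ?R" "0 \<le> ?R"
    using nonneg y \<tau> by auto
  have t2: "\<tau>\<^sup>2 \<le> \<tau>" "\<tau>\<^sup>2 \<le> 1"
    using \<tau> by (auto simp: power2_eq_square mult_le_one mult_left_le)
  have "\<tau>\<^sup>2 * y \<le> \<tau> * z"
    using t2 y by (intro mult_mono) (use \<tau> in auto)
  then have ty: "\<tau>\<^sup>2 * y \<le> ?R" using R by linarith
  have ts: "\<tau>\<^sup>2 * s \<le> ?R"
    using mult_right_mono[OF t2(2) nonneg(2)] R by linarith
  have "Y \<le> 20 / \<nu> * (Q * (y + 40 / \<nu> * s))"
    using mult_left_mono[OF coarse, of "20 / \<nu>"] \<nu> by simp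
  then have "\<tau>\<^sup>2 * Y \<le> \<tau>\<^sup>2 * (20 / \<nu> * (Q * (y + 40 / \<nu> * s)))"
    by (intro mult_left_mono) auto
  also have "\<dots> = 20 / \<nu> * Q * (\<tau>\<^sup>2 * y + 40 / \<nu> * (\<tau>\<^sup>2 * s))"
    by (simp add: algebra_simps)
  also have "\<dots> \<le> 20 / \<nu> * Q * (?R + 40 / \<nu> * ?R)"
    using ty ts \<nu> PQ by (intro mult_left_mono add_mono) auto
  finally have tY: "\<tau>\<^sup>2 * Y \<le> 20 / \<nu> * Q * (?R + 40 / \<nu> * ?R)" .
  have "x + 2 / \<nu> * (2 * s + 2 * (\<tau> * M)\<^sup>2 * Y) = x + 4 / \<nu> * s + 4 / \<nu> * M\<^sup>2 * (\<tau>\<^sup>2 * Y)"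
    by (simp add: power_mult_distrib algebra_simps)
  also have "\<dots> \<le> ?R + 4 / \<nu> * ?R + 4 / \<nu> * M\<^sup>2 * (20 / \<nu> * Q * (?R + 40 / \<nu> * ?R))"
    using R tY \<nu> by (intro add_mono mult_left_mono) auto
  also have "\<dots> = (1 + 4 / \<nu> + (4 / \<nu> * (20 / \<nu>)) * M\<^sup>2 * Q * (1 + 40 / \<nu>)) * ?R"
    by (simp only: algebra_simps mult_1_left mult_1_right)
  also have "4 / \<nu> * (20 / \<nu>) = 80 / \<nu>\<^sup>2"
    by (simp add: power2_eq_square)
  finally have "P * (x + 2 / \<nu> * (2 * s + 2 * (\<tau> * M)\<^sup>2 * Y))
      \<le> P * ((1 + 4 / \<nu> + 80 / \<nu>\<^sup>2 * M\<^sup>2 * Q * (1 + 40 / \<nu>)) * ?R)"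
    using PQ by (intro mult_left_mono) auto
  then show ?thesis using fine by (simp add: mult.assoc)
qed

theorem theorem4p4:
  fixes \<Omega> :: "(real^'d) set"
    and T \<nu>0 \<nu>1 \<mu>0 K1 :: real
    and a :: "(real^'d) \<times> real \<Rightarrow> real^'d^'d" and a0 :: "(real^'d) \<times> real \<Rightarrow> real"
    and \<alpha> :: "(real^'d) \<times> real \<Rightarrow> real^'d^'d" and \<beta> \<gamma> :: "(real^'d) \<times> real \<Rightarrow> real^'d"
    and g :: "(real^'d) \<times> real \<Rightarrow> real"
    and K :: "real \<Rightarrow> real" and \<omega> :: "nat \<Rightarrow> nat \<Rightarrow> nat \<Rightarrow> real"
    and r :: nat and S :: "real \<Rightarrow> (real^'d \<Rightarrow> real) set"
  assumes "polyhedral_domain \<Omega>" and "T > 0"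
    and "elliptic_coeffs \<Omega> T a a0"
    and "\<nu>0 > 0"
    and "\<And>t v. t \<in> {0..T} \<Longrightarrow> v \<in> H10 \<Omega> \<Longrightarrow> A_form \<Omega> a a0 t v v \<ge> \<nu>0 * (Hnorm \<Omega> 1 v)\<^sup>2"
    and "\<And>t u v. t \<in> {0..T} \<Longrightarrow> u \<in> H10 \<Omega> \<Longrightarrow> v \<in> H10 \<Omega> \<Longrightarrow>
           \<bar>A_form \<Omega> a a0 t u v\<bar> \<le> \<nu>1 * Hnorm \<Omega> 1 u * Hnorm \<Omega> 1 v"
    and "B_coeffs \<Omega> \<alpha> \<beta> \<gamma> g"
    and "\<mu>0 > 0"
    and "\<And>u v. u \<in> H10 \<Omega> \<Longrightarrow> v \<in> H10 \<Omega> \<Longrightarrow>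
           \<bar>B_tilde \<Omega> \<alpha> \<beta> \<gamma> g u u v\<bar> \<le> \<mu>0 * Hnorm \<Omega> 1 u * Hnorm \<Omega> 1 v"
    and "fe_family \<Omega> r S"
    and "K absolutely_integrable_on {0..T}"
    and "quadrature_weights T K K1 \<omega>"
  shows "\<exists>C>0. \<forall>h H N \<Delta>t f UH Uh.
           0 < h \<longrightarrow> h < H \<longrightarrow> H \<le> 1 \<longrightarrow>
           1 \<le> N \<longrightarrow> \<Delta>t = T / real N \<longrightarrow>
           \<Delta>t \<le> min (1/2) (7 * \<nu>0\<^sup>2 / (8 * \<mu>0\<^sup>2 * K1\<^sup>2 * T)) \<longrightarrow>
           (\<forall>t\<in>{0<..T}. f t \<in> L2 \<Omega>) \<longrightarrow>
           coarse_step \<Omega> (A_form \<Omega> a a0) (B_tilde \<Omega> \<alpha> \<beta> \<gamma> g) \<Delta>t N (\<omega> N) f (S H) UH \<longrightarrow>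
           fine_step \<Omega> (A_form \<Omega> a a0) (B_tilde \<Omega> \<alpha> \<beta> \<gamma> g) \<Delta>t N (\<omega> N) f (S h) UH Uh \<longrightarrow>
           (\<forall>n\<in>{1..N}.
              L2_norm \<Omega> (Uh n)
              + sqrt (\<Sum>i=1..n. (L2_norm \<Omega> (\<lambda>x. Uh i x - Uh (i - 1) x))\<^sup>2)
              + sqrt \<nu>0 / 2 * sqrt (\<Sum>i=1..n. \<Delta>t * (Hnorm \<Omega> 1 (Uh i))\<^sup>2)
              \<le> C * sqrt ((L2_norm \<Omega> (Uh 0))\<^sup>2 + \<Delta>t * (Hnorm \<Omega> 1 (UH 0))\<^sup>2
                            + \<Delta>t * (\<Sum>i=1..n. (L2_norm \<Omega> (f (real i * \<Delta>t)))\<^sup>2)))"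
proof -
  note T = assms(2) and \<nu>0 = assms(4) and coercive = assms(5) and \<mu>0 = assms(8) and B = assms(9)
  have S: "S h \<subseteq> H10 \<Omega>" if "0 < h" "h \<le> 1" for h
    using assms(10) that by (auto simp: fe_family_def)
  have \<omega>: "\<bar>\<omega> N j i\<bar> \<le> K1" if "j \<in> {1..N}" "i \<in> {1..j}" for N j i
    using assms(12) that by (auto simp: quadrature_weights_def)
  \<comment> \<open>The bound \<open>K1\<close> cannot vanish, since the weight at the newest node does not.\<close>
  have "\<omega> 1 1 1 \<noteq> 0"
    using assms(12) by (simp add: quadrature_weights_def)
  then have K1: "K1 > 0"
    using \<omega>[of 1 1 1] by simp
  define M where "M = \<mu>0 * K1"
  define P where "P = exp (2 * M\<^sup>2 * T\<^sup>2 / \<nu>0\<^sup>2)"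
  define Q where "Q = exp (800 * M\<^sup>2 * T\<^sup>2 / \<nu>0\<^sup>2)"
  define C0 where "C0 = P * (1 + 4 / \<nu>0 + 80 / \<nu>0\<^sup>2 * M\<^sup>2 * Q * (1 + 40 / \<nu>0))"
  have M0: "M > 0" using \<mu>0 K1 by (simp add: M_def)
  have PQ: "1 \<le> P" "1 \<le> Q" by (auto simp: P_def Q_def)
  have "0 < 1 + 4 / \<nu>0 + 80 / \<nu>0\<^sup>2 * M\<^sup>2 * Q * (1 + 40 / \<nu>0)"
    using \<nu>0 PQ by (intro add_pos_nonneg) auto
  then have C0: "C0 > 0" using PQ by (simp add: C0_def)
  show ?thesis
  \<comment> \<open>Each term on the left, without the factor \<open>1 / 2\<close> of the third, is at most \<open>sqrt C0\<close> times the root on the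
    right, and \<open>5 / 2 = 1 + 1 + 1 / 2\<close>.\<close>
  proof (intro exI[of _ "(5 / 2) * sqrt C0"] conjI allI impI ballI)
    show "0 < (5 / 2) * sqrt C0" using C0 by simp
  next
    fix h H :: real and N :: nat and \<Delta>t :: real and f UH Uh n
    assume h: "0 < h" "h < H" "H \<le> 1" and N: "1 \<le> N" and \<Delta>t: "\<Delta>t = T / real N"
      and le: "\<Delta>t \<le> min (1/2) (7 * \<nu>0\<^sup>2 / (8 * \<mu>0\<^sup>2 * K1\<^sup>2 * T))"
      and f: "\<forall>t\<in>{0<..T}. f t \<in> L2 \<Omega>"
      and coarse: "coarse_step \<Omega> (A_form \<Omega> a a0) (B_tilde \<Omega> \<alpha> \<beta> \<gamma> g) \<Delta>t N (\<omega> N) f (S H) UH"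
      and fine: "fine_step \<Omega> (A_form \<Omega> a a0) (B_tilde \<Omega> \<alpha> \<beta> \<gamma> g) \<Delta>t N (\<omega> N) f (S h) UH Uh"
      and n: "n \<in> {1..N}"
    have \<tau>: "0 < \<Delta>t" "\<Delta>t \<le> T" "\<Delta>t \<le> 1"
      using \<Delta>t T N le divide_left_mono[of 1 "real N" T] by auto
    have SH: "S H \<subseteq> H10 \<Omega>" and Sh: "S h \<subseteq> H10 \<Omega>" using S h by auto
    have UH: "UH i \<in> H10 \<Omega>" if "i \<le> N" for i
      using coarse SH that by (auto simp: coarse_step_def)
    have small: "\<Delta>t * (\<mu>0 * K1) \<le> 19 / 20 * \<nu>0"
      using \<tau> \<nu>0 M0 le unfolding M_def
      by (intro implicit_node_absorbed[where T = T]) (auto simp: power_mult_distrib mult_ac)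
    define D E Y s where "D = (\<Sum>i=1..n. (L2_norm \<Omega> (\<lambda>x. Uh i x - Uh (i - 1) x))\<^sup>2)"
      and "E = (\<Sum>i=1..n. \<Delta>t * (Hnorm \<Omega> 1 (Uh i))\<^sup>2)"
      and "Y = (\<Sum>i=1..n. \<Delta>t * (Hnorm \<Omega> 1 (UH i))\<^sup>2)"
      and "s = \<Delta>t * (\<Sum>i=1..n. (L2_norm \<Omega> (f (real i * \<Delta>t)))\<^sup>2)"
    define R where "R = (L2_norm \<Omega> (Uh 0))\<^sup>2 + \<Delta>t * (Hnorm \<Omega> 1 (UH 0))\<^sup>2 + s"
    let ?X = "(L2_norm \<Omega> (Uh n))\<^sup>2 + D + \<nu>0 * E"
    have D0: "0 \<le> D" and E0: "0 \<le> \<nu>0 * E" and s0: "0 \<le> s"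
      using \<tau> \<nu>0 by (auto simp: D_def E_def s_def sum_nonneg)
    have coarse_bound: "\<nu>0 / 20 * Y \<le> Q * ((L2_norm \<Omega> (UH 0))\<^sup>2 + 40 / \<nu>0 * s)"
      unfolding Y_def Q_def s_def M_def
      by (rule coarse_stability[OF coarse SH \<Delta>t T n _ _ _ _ \<nu>0 small])
         (use f in blast, (rule coercive B \<omega>; assumption)+)
    have "?X \<le> P * ((L2_norm \<Omega> (Uh 0))\<^sup>2
        + 2 / \<nu>0 * (\<Delta>t * (\<Sum>i=1..n. (L2_norm \<Omega> (f (real i * \<Delta>t)) + \<Delta>t * M * Hnorm \<Omega> 1 (UH i))\<^sup>2)))"
      unfolding D_def E_def P_def M_def
      by (rule fine_stability[OF fine Sh _ \<Delta>t T n _ _ _ _ \<nu>0])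
         ((rule UH; assumption), use f in blast, (rule coercive B \<omega>; assumption)+)
    also have "\<dots> \<le> P * ((L2_norm \<Omega> (Uh 0))\<^sup>2 + 2 / \<nu>0 * (2 * s + 2 * (\<Delta>t * M)\<^sup>2 * Y))"
    proof -
      have sq: "(v + w)\<^sup>2 \<le> 2 * v\<^sup>2 + 2 * w\<^sup>2" for v w :: real
        using sum_squares_bound[of v w] by (simp add: power2_sum)
      have "\<Delta>t * (\<Sum>i=1..n. (L2_norm \<Omega> (f (real i * \<Delta>t)) + \<Delta>t * M * Hnorm \<Omega> 1 (UH i))\<^sup>2)
          \<le> \<Delta>t * (\<Sum>i=1..n. 2 * (L2_norm \<Omega> (f (real i * \<Delta>t)))\<^sup>2 + 2 * (\<Delta>t * M * Hnorm \<Omega> 1 (UH i))\<^sup>2)"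
        using \<tau> by (intro mult_left_mono sum_mono sq) auto
      also have "\<dots> = 2 * s + 2 * (\<Delta>t * M)\<^sup>2 * Y"
        by (simp add: s_def Y_def sum.distrib sum_distrib_left distrib_left power_mult_distrib mult_ac)
      finally show ?thesis
        using PQ \<nu>0 by (intro mult_left_mono add_left_mono) auto
    qed
    finally have fine_bound:
      "?X \<le> P * ((L2_norm \<Omega> (Uh 0))\<^sup>2 + 2 / \<nu>0 * (2 * s + 2 * (\<Delta>t * M)\<^sup>2 * Y))" .
    have X: "?X \<le> C0 * R"
      unfolding C0_def R_def
      by (rule combine_grid_bounds[OF \<tau>(1,3) \<nu>0 PQ _ s0 _ _ coarse_bound fine_bound])
         (auto simp: L2_norm_le_Hnorm L2_norm_nonneg power_mono)
    have root: "v \<le> sqrt C0 * sqrt R" if "v\<^sup>2 \<le> ?X" for v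
      using real_le_rsqrt[of v "C0 * R"] that X by (simp add: real_sqrt_mult)
    have "L2_norm \<Omega> (Uh n) \<le> sqrt C0 * sqrt R"
      using D0 E0 by (intro root) auto
    moreover have "sqrt D \<le> sqrt C0 * sqrt R"
      using D0 E0 by (intro root) auto
    moreover have "sqrt \<nu>0 * sqrt E \<le> sqrt C0 * sqrt R"
      using D0 E0 \<nu>0 by (intro root) (auto simp: power_mult_distrib zero_le_mult_iff)
    ultimately have "L2_norm \<Omega> (Uh n) + sqrt D + sqrt \<nu>0 / 2 * sqrt E \<le> 5 / 2 * sqrt C0 * sqrt R"
      by linarith
    then show "L2_norm \<Omega> (Uh n)
              + sqrt (\<Sum>i=1..n. (L2_norm \<Omega> (\<lambda>x. Uh i x - Uh (i - 1) x))\<^sup>2)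
              + sqrt \<nu>0 / 2 * sqrt (\<Sum>i=1..n. \<Delta>t * (Hnorm \<Omega> 1 (Uh i))\<^sup>2)
              \<le> (5 / 2) * sqrt C0 * sqrt ((L2_norm \<Omega> (Uh 0))\<^sup>2 + \<Delta>t * (Hnorm \<Omega> 1 (UH 0))\<^sup>2
                            + \<Delta>t * (\<Sum>i=1..n. (L2_norm \<Omega> (f (real i * \<Delta>t)))\<^sup>2))"
      unfolding D_def E_def R_def s_def .
  qed
qed

end
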